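(* Let $\mathcal A$ be a commutative semiring with negation map $(-)$ and $\mathcal T\subseteq\mathcal A\setminus\{\mathbb 0\}$ a multiplicative submonoid containing $\mathbb 1$, such that $(\mathcal A,\mathcal T,(-))$ is a cancelative meta-tangible $\mathcal T$-triple. Let $A$ be an $n\times n$ matrix all of whose entries lie in $\mathcal T\cup\{\mathbb 0\}$. If the rows of $A$ are $\circ$-dependent, then $|A|\in\mathcal A^\circ$.
   Context: A commutative semiring: commutative associative addition with neutral $\mathbb 0$, commutative associative multiplication with identity $\mathbb 1$, distributive, $x\mathbb 0=\mathbb 0$. Negation map: $(-):\mathcal A\to\mathcal A$ with $(-)(x+y)=(-)x+(-)y$, $(-)((-)x)=x$, $(-)(xy)=((-)x)y$, $(-)\mathcal T\subseteq\mathcal T$. Write $x(-)y:=x+((-)y)$, $x^\circ:=x(-)x$, $\mathcal A^\circ=\{x^\circ:x\in\mathcal A\}$. $(\mathcal A,\mathcal T,(-))$ is a $\mathcal T$-triple if $\mathcal T\cap\mathcal A^\circ=\emptyset$ and every element of $\mathcal A$ is a finite sum of elements of $\mathcal T$; meta-tangible if $a+b\in\mathcal T$ for all $a,b\in\mathcal T$ with $b\neq(-)a$; cancelative if $ab_1=ab_2$ with $a\in\mathcal T$, $b_i\in\mathcal A$ implies $b_1=b_2$. A set of vectors $v_1,\dots,v_m\in\mathcal A^n$ is $\circ$-dependent if there are (some of) the $v_j$ and $\alpha_j\in\mathcal T$ with $\sum_j\alpha_jv_j\in(\mathcal A^n)^\circ$, i.e. every coordinate of $\sum_j\alpha_jv_j$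 lies in $\mathcal A^\circ$. The $(-)$-determinant is $|A|=\sum_{\pi\in S_n}(-)^\pi\prod_ia_{i,\pi(i)}$, where $(-)^\pi x$ is $x$ for even $\pi$ and $(-)x$ for odd $\pi$. *)

theory Defs
  imports "HOL-Combinatorics.Permutations"
begin

definition negation_map :: "('a::comm_semiring_1 \<Rightarrow> 'a) \<Rightarrow> 'a set \<Rightarrow> bool" where
  "negation_map neg T \<longleftrightarrow>
     (\<forall>x y. neg (x + y) = neg x + neg y) \<and>
     (\<forall>x. neg (neg x) = x) \<and>
     (\<forall>x y. neg (x * y) = neg x * y) \<and>
     neg ` T \<subseteq> T"

definition neg_minus :: "('a::comm_semiring_1 \<Rightarrow> 'a) \<Rightarrow> 'a \<Rightarrow> 'a \<Rightarrow> 'a" where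
  "neg_minus neg x y = x + neg y"

definition quasi_zeros :: "('a::comm_semiring_1 \<Rightarrow> 'a) \<Rightarrow> 'a set" where
  "quasi_zeros neg = {neg_minus neg x x | x. True}"

definition T_triple :: "('a::comm_semiring_1 \<Rightarrow> 'a) \<Rightarrow> 'a set \<Rightarrow> bool" where
  "T_triple neg T \<longleftrightarrow>
     T \<inter> quasi_zeros neg = {} \<and>
     (\<forall>x::'a. \<exists>xs. set xs \<subseteq> T \<and> x = sum_list xs)"

definition meta_tangible :: "('a::comm_semiring_1 \<Rightarrow> 'a) \<Rightarrow> 'a set \<Rightarrow> bool" where
  "meta_tangible neg T \<longleftrightarrow> (\<forall>a\<in>T. \<forall>b\<in>T. b \<noteq> neg a \<longrightarrow> a + b \<in> T)"

definition cancelative :: "'a::comm_semiring_1 set \<Rightarrow> bool" where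
  "cancelative T \<longleftrightarrow> (\<forall>a\<in>T. \<forall>b1 b2. a * b1 = a * b2 \<longrightarrow> b1 = b2)"

definition neg_sign :: "('a::comm_semiring_1 \<Rightarrow> 'a) \<Rightarrow> ('n \<Rightarrow> 'n) \<Rightarrow> 'a \<Rightarrow> 'a" where
  "neg_sign neg p x = (if evenperm p then x else neg x)"

definition neg_det :: "('a::comm_semiring_1 \<Rightarrow> 'a) \<Rightarrow> ('n::finite \<Rightarrow> 'n \<Rightarrow> 'a) \<Rightarrow> 'a" where
  "neg_det neg A = (\<Sum>p\<in>{p. p permutes (UNIV::'n set)}. neg_sign neg p (\<Prod>i\<in>UNIV. A i (p i)))"

definition circ_dependent ::
  "('a::comm_semiring_1 \<Rightarrow> 'a) \<Rightarrow> 'a set \<Rightarrow> ('m::finite \<Rightarrow> 'n \<Rightarrow> 'a) \<Rightarrow> bool" where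
  "circ_dependent neg T v \<longleftrightarrow>
     (\<exists>S::'m set. S \<noteq> {} \<and> (\<exists>\<alpha>. (\<forall>j\<in>S. \<alpha> j \<in> T) \<and>
        (\<forall>k. (\<Sum>j\<in>S. \<alpha> j * v j k) \<in> quasi_zeros neg)))"

end

theory Submission
  imports Defs "HOL-Analysis.Determinants"
begin

text \<open>
  Write \<open>e = (-)1\<close>; the quasi-zeros form the ideal generated by \<open>1 + e\<close>. Rescaling the rows (which can
  be undone at the end, as tangible factors cancel from quasi-zeros) we may assume that the rows
  with indices in \<open>S\<close> add up to a vector of quasi-zeros. Every column is then decomposed into a sum
  of simpler columns, and the determinant is expanded multilinearly.

  Generically, the simple columns are \<open>w (e_i (-) e_k)\<close> with \<open>i, k\<close> in \<open>S\<close> (and \<open>w e_i\<close> with \<open>i\<close> outside \<open>S\<close>).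
  Up to a factor their determinant is \<open>P + Q e\<close>, where \<open>P - Q\<close> is the determinant of a singular
  real matrix, so \<open>P = Q\<close>. The decomposition rests on absorption: if \<open>a, b\<close> and \<open>a + b\<close> are
  tangible and \<open>a + b \<noteq> b\<close>, then \<open>a + b (-) b = a\<close>.

  It fails only if \<open>e = 1\<close> and some odd multiple of a tangible is a quasi-zero. Then \<open>T\<close> is totally
  ordered by \<open>a + b \<in> {a, b}\<close>, and with \<open>N\<close> the least odd number that is a quasi-zero the columns
  decompose into multiples of vectors of natural numbers whose sum over \<open>S\<close> is even or at least \<open>N\<close>.
  The permanent of such vectors is again even or at least \<open>N\<close>.
\<close>

subsection \<open>Permanents of matrices of natural numbers\<close>

text \<open>When \<open>e = 1\<close> and \<open>N\<close> is the least odd number that is a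
  quasi-zero, these are exactly the naturals that are quasi-zeros.\<close>

definition even_or_ge :: "nat \<Rightarrow> nat \<Rightarrow> bool" where
  "even_or_ge N x \<longleftrightarrow> even x \<or> N \<le> x"

lemma even_or_ge_add: "even_or_ge N x \<Longrightarrow> even_or_ge N y \<Longrightarrow> even_or_ge N (x + y)"
  unfolding even_or_ge_def by auto

lemma even_or_ge_mult: "even_or_ge N x \<Longrightarrow> even_or_ge N (c * x)"
  unfolding even_or_ge_def by (cases c) auto

lemma even_or_ge_sum:
  "(\<And>i. i \<in> F \<Longrightarrow> even_or_ge N (f i)) \<Longrightarrow> even_or_ge N (\<Sum>i\<in>F. f i)"
proof (induction F rule: infinite_finite_induct)
  case (insert x F)
  then show ?case using even_or_ge_add[of N "f x" "sum f F"] by simp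
qed (auto simp: even_or_ge_def)

text \<open>If the weighted sum is odd and below \<open>N\<close>, some \<open>c i * M i\<close> is
  odd. Each \<open>M i + M k\<close> with \<open>c k > 0\<close> is then below \<open>N\<close>,
  hence even, so every such \<open>M k\<close> is odd. So the sum of the \<open>c k\<close> is odd
  too and at least \<open>N\<close>, although the weighted sum bounds it.\<close>

lemma even_or_ge_weighted_sum:
  fixes c M :: "'r \<Rightarrow> nat"
  assumes fin: "finite S"
    and c: "even_or_ge N (\<Sum>i\<in>S. c i)"
    and M: "\<And>i k. i \<in> S \<Longrightarrow> k \<in> S \<Longrightarrow> i \<noteq> k \<Longrightarrow> even_or_ge N (M i + M k)"
  shows "even_or_ge N (\<Sum>i\<in>S. c i * M i)"
proof (rule ccontr)
  assume "\<not> ?thesis"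
  then have odd: "odd (\<Sum>i\<in>S. c i * M i)" and small: "(\<Sum>i\<in>S. c i * M i) < N"
    by (auto simp: even_or_ge_def)
  obtain i where i: "i \<in> S" "odd (c i * M i)"
    using odd dvd_sum[of S 2 "\<lambda>i. c i * M i"] by blast
  have odd_M: "odd (M k)" if k: "k \<in> S" "c k > 0" for k
  proof (cases "k = i")
    case True then show ?thesis using i by simp
  next
    case False
    have "c i > 0" using i by (cases "c i") auto
    have "M i + M k \<le> c i * M i + c k * M k"
      using \<open>c i > 0\<close> k by (intro add_mono) auto
    also have "\<dots> = (\<Sum>l\<in>{i,k}. c l * M l)" using False by simp
    also have "\<dots> \<le> (\<Sum>l\<in>S. c l * M l)"
      by (rule sum_mono2) (use fin i k in auto)
    finally have "M i + M k < N" using small by simp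
    then have "even (M i + M k)" using M[of i k] i k False by (auto simp: even_or_ge_def)
    then show ?thesis using i by auto
  qed
  have "even (c k * M k) = even (c k)" if "k \<in> S" for k
    using odd_M[OF that] by (cases "c k") auto
  then have "even (c k * M k + c k)" if "k \<in> S" for k using that by auto
  then have "even (\<Sum>k\<in>S. c k * M k + c k)" by (intro dvd_sum) auto
  then have "odd (\<Sum>k\<in>S. c k)" using odd by (simp add: sum.distrib)
  then have "N \<le> (\<Sum>k\<in>S. c k)" using c by (auto simp: even_or_ge_def)
  also have "\<dots> \<le> (\<Sum>k\<in>S. c k * M k)"
  proof (rule sum_mono)
    fix k assume "k \<in> S"
    show "c k \<le> c k * M k" using odd_M[OF \<open>k \<in> S\<close>] by (cases "c k"; cases "M k") auto
  qed
  finally show False using small by simp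
qed

text \<open>Expansion along the first column; \<open>R\<close> holds the rows not yet used. For
  finite \<open>R\<close> the value is 0 unless there are as many columns as rows.\<close>

fun list_permanent :: "('r \<Rightarrow> nat) list \<Rightarrow> 'r set \<Rightarrow> nat" where
  "list_permanent [] R = (if R = {} then 1 else 0)"
| "list_permanent (c # cs) R = (\<Sum>i\<in>R. c i * list_permanent cs (R - {i}))"

definition add_row :: "'r \<Rightarrow> 'r \<Rightarrow> ('r \<Rightarrow> nat) \<Rightarrow> 'r \<Rightarrow> nat" where
  "add_row i k c = c(k := c i + c k)"

lemma list_permanent_add_row_irrelevant:
  "k \<notin> R \<Longrightarrow> list_permanent (map (add_row i k) cs) R = list_permanent cs R"
proof (induction cs arbitrary: R)
  case (Cons c cs)
  show ?case by (auto simp: add_row_def[of i k c] Cons intro!: sum.cong)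
qed simp

text \<open>Linearity of the permanent in one row: the two minors differ only in which of the rows
  \<open>i\<close>, \<open>k\<close> survives, and no sign arises when one takes the place of the
  other.\<close>

lemma list_permanent_merge_rows:
  assumes "finite R" "i \<in> R" "k \<in> R" "i \<noteq> k"
  shows "list_permanent cs (R - {i}) + list_permanent cs (R - {k}) =
         list_permanent (map (add_row i k) cs) (R - {i})"
  using assms
proof (induction cs arbitrary: R)
  case Nil then show ?case by auto
next
  case (Cons c cs)
  define Q where "Q = R - {i,k}"
  have Q: "R - {i} = insert k Q" "R - {k} = insert i Q" "k \<notin> Q" "i \<notin> Q" "finite Q"
    using Cons.prems by (auto simp: Q_def)
  \<comment> \<open>Deleting \<open>l\<close> keeps both \<open>i\<close> and \<open>k\<close>, so
    the same pair of rows can be merged in the smaller row set.\<close>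
  have IH: "list_permanent cs (insert k Q - {l}) + list_permanent cs (insert i Q - {l}) =
      list_permanent (map (add_row i k) cs) (insert k Q - {l})" if "l \<in> Q" for l
  proof -
    have "insert k Q - {l} = (R - {l}) - {i}" "insert i Q - {l} = (R - {l}) - {k}"
      using Q that Cons.prems by auto
    then show ?thesis using Cons.IH[of "R - {l}"] Cons.prems that Q by auto
  qed
  have "list_permanent (c # cs) (R - {i}) + list_permanent (c # cs) (R - {k}) =
     (c i + c k) * list_permanent cs Q +
     (\<Sum>l\<in>Q. c l * (list_permanent cs (insert k Q - {l}) + list_permanent cs (insert i Q - {l})))"
    using Q by (simp add: sum.distrib algebra_simps)
  also have "\<dots> = (c i + c k) * list_permanent (map (add_row i k) cs) Q +
     (\<Sum>l\<in>Q. add_row i k c l * list_permanent (map (add_row i k) cs) (insert k Q - {l}))"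
    using Q IH by (auto simp: list_permanent_add_row_irrelevant add_row_def[of i k c] intro!: sum.cong)
  also have "\<dots> = list_permanent (map (add_row i k) (c # cs)) (R - {i})"
    using Q by (simp add: add_row_def[of i k c])
  finally show ?case .
qed

text \<open>Merging two rows of \<open>S\<close> preserves the column sums over \<open>S\<close>, so the minors along the first column
  are pairwise congruent modulo 2 unless a sum of two of them reaches \<open>N\<close>.\<close>

lemma even_or_ge_list_permanent:
  assumes "finite R" "S \<subseteq> R" "S \<noteq> {}"
    and "\<And>c. c \<in> set cs \<Longrightarrow> even_or_ge N (\<Sum>i\<in>S. c i)"
  shows "even_or_ge N (list_permanent cs R)"
  using assms
proof (induction "length cs" arbitrary: cs R S)
  \<comment> \<open>Nonempty \<open>S\<close> makes \<open>R\<close> nonempty, so the permanent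
    without columns is 0.\<close>
  case 0 then show ?case by (auto simp: even_or_ge_def)
next
  case (Suc n)
  then obtain c ds where cs: "cs = c # ds" "length ds = n" by (cases cs) auto
  note prems = Suc.prems[unfolded cs(1)]
  note IH = Suc.hyps(1)
  have fS: "finite S" using prems finite_subset by blast
  have "list_permanent cs R =
     (\<Sum>i\<in>R - S. c i * list_permanent ds (R - {i})) + (\<Sum>i\<in>S. c i * list_permanent ds (R - {i}))"
    using prems by (simp add: sum.subset_diff cs)
  moreover have "even_or_ge N (\<Sum>i\<in>R - S. c i * list_permanent ds (R - {i}))"
  proof (rule even_or_ge_sum)
    fix i assume "i \<in> R - S"
    then have "even_or_ge N (list_permanent ds (R - {i}))"
      using prems by (intro IH[where S=S]) (auto simp: cs)
    then show "even_or_ge N (c i * list_permanent ds (R - {i}))" by (rule even_or_ge_mult)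
  qed
  moreover have "even_or_ge N (\<Sum>i\<in>S. c i * list_permanent ds (R - {i}))"
  proof (rule even_or_ge_weighted_sum)
    fix i k assume ik: "i \<in> S" "k \<in> S" "i \<noteq> k"
    have "even_or_ge N (list_permanent (map (add_row i k) ds) (R - {i}))"
    proof (rule IH[where S="S - {i}"])
      fix d assume "d \<in> set (map (add_row i k) ds)"
      then obtain d0 where d0: "d0 \<in> set ds" "d = add_row i k d0" by auto
      define Q where "Q = S - {i,k}"
      have Q: "S - {i} = insert k Q" "S = insert i (insert k Q)" "k \<notin> Q" "i \<notin> Q" "finite Q"
        using ik fS by (auto simp: Q_def)
      have "(\<Sum>l\<in>Q. d l) = (\<Sum>l\<in>Q. d0 l)"
        by (rule sum.cong) (use Q d0 in \<open>auto simp: add_row_def\<close>)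
      then have "(\<Sum>l\<in>S - {i}. d l) = d k + (\<Sum>l\<in>Q. d0 l)"
        unfolding Q(1) using Q(3-5) by simp
      also have "\<dots> = (\<Sum>l\<in>S. d0 l)"
        unfolding Q(2) using Q(3-5) ik d0 by (simp add: add_row_def)
      finally show "even_or_ge N (\<Sum>l\<in>S - {i}. d l)" using prems(4) d0 by simp
    qed (use prems ik in \<open>auto simp: cs\<close>)
    then show "even_or_ge N (list_permanent ds (R - {i}) + list_permanent ds (R - {k}))"
      using list_permanent_merge_rows[of R i k ds] prems ik by (simp add: subset_iff)
  qed (use prems fS in \<open>auto simp: cs\<close>)
  ultimately show ?case using even_or_ge_add by metis
qed

section \<open>Permanents as sums over bijections\<close>

definition bijections :: "'c set \<Rightarrow> 'r set \<Rightarrow> ('c \<Rightarrow> 'r) set" where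
  "bijections C R = {f \<in> C \<rightarrow>\<^sub>E R. bij_betw f C R}"

text \<open>Fixing the row \<open>i\<close> assigned to column \<open>c\<close> leaves a bijection
  from \<open>C\<close> onto \<open>R - {i}\<close>; extensionality makes this splitting
  one-to-one.\<close>

lemma sum_bijections_insert:
  fixes u :: "'c \<Rightarrow> 'r \<Rightarrow> nat"
  assumes "finite C" "c \<notin> C" "finite R"
  shows "(\<Sum>f\<in>bijections (insert c C) R. \<Prod>j\<in>insert c C. u j (f j)) =
         (\<Sum>i\<in>R. u c i * (\<Sum>f\<in>bijections C (R - {i}). \<Prod>j\<in>C. u j (f j)))"
proof -
  have fin: "finite (bijections C (R - {i}))" for i
    unfolding bijections_def
    by (rule finite_subset[OF _ finite_PiE[of C "\<lambda>_. R - {i}"]]) (use assms in auto)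
  have "(\<Sum>i\<in>R. u c i * (\<Sum>f\<in>bijections C (R - {i}). \<Prod>j\<in>C. u j (f j))) =
     (\<Sum>(i,f)\<in>Sigma R (\<lambda>i. bijections C (R - {i})). u c i * (\<Prod>j\<in>C. u j (f j)))"
    using assms fin by (simp add: sum_distrib_left sum.Sigma)
  also have "\<dots> = (\<Sum>f\<in>bijections (insert c C) R. \<Prod>j\<in>insert c C. u j (f j))"
  proof (rule sum.reindex_bij_witness[where i="\<lambda>g. (g c, restrict g C)" and j="\<lambda>(i,f). f(c := i)"])
    fix a assume "a \<in> Sigma R (\<lambda>i. bijections C (R - {i}))"
    then obtain i f where a: "a = (i,f)" "i \<in> R" "f \<in> C \<rightarrow>\<^sub>E R - {i}" "bij_betw f C (R - {i})"
      by (auto simp: bijections_def)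
    show "((case a of (i,f) \<Rightarrow> f(c := i)) c, restrict (case a of (i,f) \<Rightarrow> f(c := i)) C) = a"
      using a assms by (auto simp: fun_eq_iff restrict_def PiE_def extensional_def)
    have "bij_betw (f(c := i)) C (R - {i})"
      using a(4) assms(2) by (metis (no_types, lifting) bij_betw_cong fun_upd_other)
    then have "bij_betw (f(c := i)) (insert c C) (insert i (R - {i}))"
      using assms(2) notIn_Un_bij_betw[of c C "f(c:=i)" "R - {i}"] by simp
    then show "(case a of (i,f) \<Rightarrow> f(c := i)) \<in> bijections (insert c C) R"
      using a by (auto simp: bijections_def insert_absorb PiE_iff extensional_def)
    have "(\<Prod>j\<in>C. u j ((f(c := i)) j)) = (\<Prod>j\<in>C. u j (f j))"
      using assms by (intro prod.cong) auto
    then show "(\<Prod>j\<in>insert c C. u j ((case a of (i,f) \<Rightarrow> f(c := i)) j)) =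
        (case a of (i,f) \<Rightarrow> u c i * (\<Prod>j\<in>C. u j (f j)))"
      using a assms by simp
  next
    fix g assume "g \<in> bijections (insert c C) R"
    then have g: "g \<in> insert c C \<rightarrow>\<^sub>E R" "bij_betw g (insert c C) R" by (auto simp: bijections_def)
    show "(case (g c, restrict g C) of (i,f) \<Rightarrow> f(c := i)) = g"
      using g by (auto simp: fun_eq_iff restrict_def PiE_def extensional_def)
    have "g c \<notin> g ` C" "inj_on g C" "R = insert (g c) (g ` C)"
      using g(2) assms(2) by (auto simp: bij_betw_def)
    then have "inj_on g C" "g ` C = R - {g c}" by blast+
    then show "(g c, restrict g C) \<in> Sigma R (\<lambda>i. bijections C (R - {i}))"
      using g by (auto simp: bijections_def bij_betw_def)
  qed
  finally show ?thesis by simp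
qed

lemma list_permanent_bijections:
  fixes u :: "'c \<Rightarrow> 'r \<Rightarrow> nat"
  assumes "distinct xs" "finite R"
  shows "list_permanent (map u xs) R = (\<Sum>f\<in>bijections (set xs) R. \<Prod>j\<in>set xs. u j (f j))"
  using assms
proof (induction xs arbitrary: R)
  case Nil
  have "bijections ({}::'c set) R = (if R = {} then {\<lambda>_. undefined} else {})"
    by (auto simp: bijections_def bij_betw_def)
  then show ?case by (cases "R = {}") simp_all
next
  case (Cons x xs)
  then show ?case using sum_bijections_insert[of "set xs" x R u] by simp
qed

text \<open>With rows and columns both indexed by the whole type, bijections are permutations. This
  is the form in which the permanent appears as a determinant with \<open>e = 1\<close>.\<close>

lemma even_or_ge_permanent:
  fixes u :: "'n::finite \<Rightarrow> 'n \<Rightarrow> nat"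
  assumes "S \<noteq> {}" "\<And>j. even_or_ge N (\<Sum>i\<in>S. u j i)"
  shows "even_or_ge N (\<Sum>p\<in>{p. p permutes (UNIV::'n set)}. \<Prod>j\<in>UNIV. u j (p j))"
proof -
  obtain xs where xs: "set xs = (UNIV::'n set)" "distinct xs"
    using finite_distinct_list[of "UNIV::'n set"] by auto
  have "bijections (UNIV::'n set) UNIV = {p. p permutes UNIV}"
    by (auto simp: bijections_def permutes_bij intro: bij_imp_permutes)
  then show ?thesis
    using list_permanent_bijections[of xs UNIV u] xs even_or_ge_list_permanent[of UNIV S "map u xs" N] assms
    by auto
qed


subsection \<open>Determinants as multilinear functions of vectors\<close>

text \<open>The additive monoid generated by \<open>X\<close>, built one generator at a time to suit
  multilinear expansion.\<close>

inductive_set vec_sums :: "('n \<Rightarrow> 'a::comm_monoid_add) set \<Rightarrow> ('n \<Rightarrow> 'a) set" for X where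
  zero: "(\<lambda>_. 0) \<in> vec_sums X"
| add: "x \<in> X \<Longrightarrow> u \<in> vec_sums X \<Longrightarrow> (\<lambda>i. x i + u i) \<in> vec_sums X"

lemma vec_sums_base: "x \<in> X \<Longrightarrow> x \<in> vec_sums X"
  using vec_sums.add[OF _ vec_sums.zero, of x X] by simp

lemma vec_sums_add: "u \<in> vec_sums X \<Longrightarrow> v \<in> vec_sums X \<Longrightarrow> (\<lambda>i. u i + v i) \<in> vec_sums X"
proof (induction rule: vec_sums.induct)
  case (add x u)
  then show ?case using vec_sums.add[of x X "\<lambda>i. u i + v i"] by (simp add: add.assoc)
qed simp

lemma vec_sums_sum:
  "(\<And>k. k \<in> F \<Longrightarrow> f k \<in> vec_sums X) \<Longrightarrow> (\<lambda>i. \<Sum>k\<in>F. f k i) \<in> vec_sums X"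
proof (induction F rule: infinite_finite_induct)
  case (insert x F)
  then show ?case using vec_sums_add[of "f x" X "\<lambda>i. \<Sum>k\<in>F. f k i"] by simp
qed (auto intro: vec_sums.zero)

lemma vec_sums_mono: "X \<subseteq> vec_sums Y \<Longrightarrow> vec_sums X \<subseteq> vec_sums Y"
proof
  fix u assume "X \<subseteq> vec_sums Y" "u \<in> vec_sums X"
  from this(2,1) show "u \<in> vec_sums Y"
    by induction (auto intro: vec_sums.zero vec_sums_add)
qed

text \<open>
  The elements \<open>P + Q e\<close> with natural \<open>P\<close>, \<open>Q\<close> specialize to the numbers \<open>P - Q\<close>;
  an element specializing to \<open>0\<close> is a multiple of \<open>1 + e\<close>.
\<close>

definition specializes :: "'a::comm_semiring_1 \<Rightarrow> 'a \<Rightarrow> real \<Rightarrow> bool" where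
  "specializes e x z \<longleftrightarrow> (\<exists>P Q::nat. x = of_nat P + of_nat Q * e \<and> z = real P - real Q)"

lemma specializes_0: "specializes e 0 0"
  unfolding specializes_def by (rule exI[of _ 0], rule exI[of _ 0]) simp

lemma specializes_1: "specializes e 1 1"
  unfolding specializes_def by (rule exI[of _ 1], rule exI[of _ 0]) simp

lemma specializes_unit: "specializes e e (-1)"
  unfolding specializes_def by (rule exI[of _ 0], rule exI[of _ 1]) simp

lemma specializes_add:
  assumes "specializes e x z" "specializes e y w"
  shows "specializes e (x + y) (z + w)"
proof -
  obtain P Q P' Q' where "x = of_nat P + of_nat Q * e" "z = real P - real Q"
    "y = of_nat P' + of_nat Q' * e" "w = real P' - real Q'"
    using assms unfolding specializes_def by blast
  then show ?thesis unfolding specializes_def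
    by (intro exI[of _ "P + P'"] exI[of _ "Q + Q'"]) (simp add: algebra_simps)
qed

text \<open>The relation \<open>e * e = 1\<close> mirrors (-1)(-1) = 1, so the product of the two
  \<open>e\<close>-parts joins the natural part.\<close>

lemma specializes_mult:
  assumes "e * e = 1" "specializes e x z" "specializes e y w"
  shows "specializes e (x * y) (z * w)"
proof -
  obtain P Q P' Q' where *: "x = of_nat P + of_nat Q * e" "z = real P - real Q"
    "y = of_nat P' + of_nat Q' * e" "w = real P' - real Q'"
    using assms unfolding specializes_def by blast
  have "x * y = of_nat P * of_nat P' + of_nat Q * of_nat Q' * (e * e) +
      (of_nat P * of_nat Q' + of_nat Q * of_nat P') * e"
    unfolding * by (simp add: algebra_simps)
  then have "x * y = of_nat (P * P' + Q * Q') + of_nat (P * Q' + Q * P') * e"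
    using assms(1) by simp
  moreover have "z * w = real (P * P' + Q * Q') - real (P * Q' + Q * P')"
    unfolding * by (simp add: algebra_simps)
  ultimately show ?thesis unfolding specializes_def by blast
qed

lemma specializes_sum:
  "(\<And>i. i \<in> F \<Longrightarrow> specializes e (f i) (g i)) \<Longrightarrow> specializes e (\<Sum>i\<in>F. f i) (\<Sum>i\<in>F. g i)"
  by (induction F rule: infinite_finite_induct) (simp_all add: specializes_0 specializes_add)

lemma specializes_prod:
  "e * e = 1 \<Longrightarrow> (\<And>i. i \<in> F \<Longrightarrow> specializes e (f i) (g i)) \<Longrightarrow>
    specializes e (\<Prod>i\<in>F. f i) (\<Prod>i\<in>F. g i)"
  by (induction F rule: infinite_finite_induct) (simp_all add: specializes_1 specializes_mult)

text \<open>Reindexing by inverse permutations, which have the same parity. It allows columns to be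
  decomposed while determinants are expanded along rows.\<close>

lemma neg_det_transpose: "neg_det neg (\<lambda>i j. A j i) = neg_det neg A"
  for A :: "'n::finite \<Rightarrow> 'n \<Rightarrow> 'a::comm_semiring_1"
proof -
  have "neg_det neg (\<lambda>i j. A j i) =
     (\<Sum>p\<in>{p. p permutes (UNIV::'n set)}. neg_sign neg (inv p) (\<Prod>i\<in>UNIV. A (inv p i) i))"
    unfolding neg_det_def by (rule sum_permutations_inverse)
  also have "\<dots> = neg_det neg A"
    unfolding neg_det_def
  proof (rule sum.cong)
    fix p assume "p \<in> {p. p permutes (UNIV::'n set)}"
    then have p: "p permutes UNIV" by simp
    have "(\<Prod>i\<in>UNIV. A (inv p i) i) = (\<Prod>i\<in>UNIV. A (inv p (p i)) (p i))"
      using prod.permute[OF p, of "\<lambda>i. A (inv p i) i"] by (simp add: comp_def)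
    also have "\<dots> = (\<Prod>i\<in>UNIV. A i (p i))"
      using permutes_inverses(2)[OF p] by simp
    finally show "neg_sign neg (inv p) (\<Prod>i\<in>UNIV. A (inv p i) i) =
        neg_sign neg p (\<Prod>i\<in>UNIV. A i (p i))"
      using evenperm_inv[of p] permutation_permutes[of p] p by (auto simp: neg_sign_def)
  qed simp
  finally show ?thesis .
qed

subsection \<open>Cancelative meta-tangible triples\<close>

locale cancelative_meta_tangible =
  fixes neg :: "'a::comm_semiring_1 \<Rightarrow> 'a" and T :: "'a set"
  assumes negation: "negation_map neg T"
    and one_T: "1 \<in> T"
    and mult_closed: "\<forall>a\<in>T. \<forall>b\<in>T. a * b \<in> T"
    and triple: "T_triple neg T"
    and meta_tangible: "meta_tangible neg T"
    and cancelative: "cancelative T"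
begin

definition e :: 'a where "e = neg 1"

abbreviation Z :: "'a set" where "Z \<equiv> quasi_zeros neg"

lemma neg_eq: "neg x = e * x"
proof -
  have "neg (1 * x) = neg 1 * x" using negation unfolding negation_map_def by blast
  then show ?thesis by (simp add: e_def)
qed

lemma e_e: "e * e = 1"
proof -
  have "neg (neg 1) = 1" using negation unfolding negation_map_def by blast
  then show ?thesis by (simp add: neg_eq)
qed

lemma e_e_mult: "e * (e * x) = x"
  by (simp add: e_e mult.assoc[symmetric])

lemma e_mult_eq_iff: "e * x = e * y \<longleftrightarrow> x = y"
  by (metis e_e_mult)

lemma Z_iff: "q \<in> Z \<longleftrightarrow> (\<exists>x. q = (1 + e) * x)"
  by (simp add: quasi_zeros_def neg_minus_def neg_eq distrib_right)

lemma Z_I: "x + e * x \<in> Z"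
  unfolding Z_iff by (rule exI[of _ x]) (simp add: distrib_right)

lemma Z_add: "x \<in> Z \<Longrightarrow> y \<in> Z \<Longrightarrow> x + y \<in> Z"
  unfolding Z_iff by (auto simp: distrib_left[symmetric])

lemma Z_mult: "x \<in> Z \<Longrightarrow> y * x \<in> Z"
  unfolding Z_iff by (auto simp: mult.left_commute[of y])

lemma Z_0: "0 \<in> Z"
  unfolding Z_iff by (rule exI[of _ 0]) simp

lemma T_mult: "a \<in> T \<Longrightarrow> b \<in> T \<Longrightarrow> a * b \<in> T"
  using mult_closed by blast

lemma T_e: "a \<in> T \<Longrightarrow> e * a \<in> T"
  using negation unfolding negation_map_def neg_eq[symmetric] by blast

lemma T_not_Z: "a \<in> T \<Longrightarrow> a \<notin> Z"
  using triple unfolding T_triple_def by (meson disjoint_iff)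

lemma T_add: "a \<in> T \<Longrightarrow> b \<in> T \<Longrightarrow> b \<noteq> e * a \<Longrightarrow> a + b \<in> T"
  using meta_tangible by (simp add: meta_tangible_def neg_eq)

lemma T_cancel: "a \<in> T \<Longrightarrow> a * x = a * y \<Longrightarrow> x = y"
  using cancelative unfolding cancelative_def by meson

text \<open>The sum \<open>a + b + e * b\<close> is tangible. Were it not \<open>a\<close>, adding
  \<open>e * a\<close> would again give a tangible, but the result is the quasi-zero of
  \<open>a + b\<close>.\<close>

lemma absorb:
  assumes "a \<in> T" "b \<in> T" "b \<noteq> e * a" "a + b \<noteq> b"
  shows "a + b + e * b = a"
proof -
  have "e * b \<noteq> e * (a + b)" using assms(4) e_mult_eq_iff by metis
  then have t: "a + b + e * b \<in> T" using assms by (intro T_add T_e)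
  show ?thesis
  proof (rule ccontr)
    assume "a + b + e * b \<noteq> a"
    then have "(a + b + e * b) + e * a \<in> T" using t assms e_mult_eq_iff by (intro T_add T_e) auto
    moreover have "(a + b + e * b) + e * a = (a + b) + e * (a + b)" by (simp add: algebra_simps)
    ultimately show False using T_not_Z Z_I by metis
  qed
qed

lemma of_nat_even_Z: "e = 1 \<Longrightarrow> even k \<Longrightarrow> of_nat k * x \<in> Z"
  unfolding Z_iff by (auto elim!: evenE simp: mult.assoc)

lemma add_of_nat_absorb: "a + b = a \<Longrightarrow> a + of_nat m * b = (a::'a)"
proof (induction m)
  case (Suc m)
  then show ?case by (simp add: algebra_simps) (metis add.commute add.left_commute)
qed simp

definition normal_form :: "'a \<Rightarrow> bool" where
  "normal_form z \<longleftrightarrow> (if e = 1 then \<exists>k. \<exists>t\<in>T. z = of_nat k * t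
     else z = 0 \<or> z \<in> T \<or> (\<exists>t\<in>T. z = t + e * t))"

text \<open>For \<open>e = 1\<close>, adding \<open>s\<close> to a multiple of \<open>t\<close>
  raises the multiple if \<open>s = t\<close> and is swallowed by a positive multiple if
  \<open>s + t = t\<close>; otherwise pairs of \<open>t\<close> vanish by absorption and only the
  parity of \<open>k\<close> counts. For \<open>e \<noteq> 1\<close>, one of \<open>s\<close> and
  \<open>t + e * t\<close> absorbs the other.\<close>

lemma normal_form_add:
  assumes "normal_form z" "s \<in> T"
  shows "normal_form (s + z)"
proof (cases "e = 1")
  case True
  then obtain k t where z: "t \<in> T" "z = of_nat k * t"
    using assms by (auto simp: normal_form_def)
  have T1: "normal_form y" if "y \<in> T" for y
    using True that by (auto simp: normal_form_def intro!: exI[of _ 1])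
  show ?thesis
  proof (cases "s = t")
    case True
    then have "s + z = of_nat (Suc k) * t" using z by (simp add: distrib_right)
    then show ?thesis using z \<open>e = 1\<close> unfolding normal_form_def by metis
  next
    case st: False
    show ?thesis
    proof (cases "s + t = t")
      case True
      show ?thesis
      proof (cases k)
        case 0 then show ?thesis using z T1 assms by simp
      next
        case (Suc l)
        have "s + z = (s + t) + of_nat l * t" using z Suc by (simp add: algebra_simps)
        also have "\<dots> = z" unfolding True using z Suc by (simp add: distrib_right)
        finally show ?thesis using assms(1) by simp
      qed
    next
      case False
      then have "s + t + t = s" using absorb[of s t] assms z st \<open>e = 1\<close> by auto
      then have "s + (t + t) = s" by (simp add: add.assoc)
      then have ev: "s + of_nat l * (t + t) = s" for l by (rule add_of_nat_absorb)
      have double: "of_nat (2 * l) * t = of_nat l * (t + t)" for l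
        by (simp add: mult_2[symmetric] ac_simps)
      show ?thesis
      proof (cases "even k")
        case True
        then obtain l where "k = 2 * l" by blast
        then have "s + z = s" using ev[of l] double[of l] z by simp
        then show ?thesis using T1 assms by simp
      next
        case odd: False
        then obtain l where "k = 2 * l + 1" using oddE by blast
        then have "z = of_nat (2 * l) * t + t" using z by (simp add: algebra_simps)
        then have "s + z = (s + of_nat l * (t + t)) + t" by (simp only: double add.assoc)
        then have "s + z = s + t" using ev by simp
        moreover have "s + t \<in> T" using T_add[of s t] st assms z \<open>e = 1\<close> by auto
        ultimately show ?thesis using T1 by simp
      qed
    qed
  qed
next
  case e: False
  have e_ne: "t \<noteq> e * t" if "t \<in> T" for t
    using e T_cancel[OF that, of 1 e] by (auto simp: mult.commute)
  from e assms consider "z = 0" | "z \<in> T" | t where "t \<in> T" "z = t + e * t"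
    by (auto simp: normal_form_def)
  then show ?thesis
  proof cases
    case 1 then show ?thesis using assms e by (auto simp: normal_form_def)
  next
    case 2 then show ?thesis using assms e T_add[of s z] by (auto simp: normal_form_def)
  next
    case 3
    have main: "normal_form (s + (t + e * t))" if "t \<in> T" "t \<noteq> e * s" for t
    proof (cases "s + t = t")
      case True
      then have "s + (t + e * t) = t + e * t" by (metis add.assoc)
      then show ?thesis using that e by (auto simp: normal_form_def)
    next
      case False
      then have "s + (t + e * t) = s" using absorb[of s t] that assms by (simp add: add.assoc)
      then show ?thesis using assms e by (auto simp: normal_form_def)
    qed
    show ?thesis
    proof (cases "t = e * s")
      case True
      \<comment> \<open>Here \<open>main\<close> excludes \<open>t\<close>, but
        \<open>e * t = s\<close> has the same quasi-zero and differs from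
        \<open>e * s\<close>.\<close>
      have "normal_form (s + (e * t + e * (e * t)))"
        using 3 True e_ne[OF assms(2)] by (intro main T_e) (auto simp: e_e_mult)
      then show ?thesis using 3 by (simp add: e_e_mult add.commute)
    next
      case False then show ?thesis using main 3 by simp
    qed
  qed
qed

lemma normal_form: "normal_form z"
proof -
  obtain xs where "set xs \<subseteq> T" "z = sum_list xs"
    using triple unfolding T_triple_def by blast
  then show ?thesis
  proof (induction xs arbitrary: z)
    case Nil
    then show ?case using one_T by (auto simp: normal_form_def intro!: exI[of _ 0])
  next
    case (Cons x xs)
    then show ?case using normal_form_add[of "sum_list xs" x] by simp
  qed
qed

text \<open>The supertropical-like situation, in which a sum of an odd number of equal tangibles can be a quasi-zero.\<close>

definition odd_quasi_zero :: bool where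
  "odd_quasi_zero \<longleftrightarrow> e = 1 \<and> (\<exists>m. \<exists>a\<in>T. odd m \<and> of_nat m * a \<in> Z)"

text \<open>Otherwise absorption works both ways, which yields \<open>a + (a + a) = a\<close>.
  Cancelling \<open>a\<close>, every odd multiple of 1 is 1, so odd multiples of tangibles are
  tangible and never quasi-zeros.\<close>

lemma odd_quasi_zero_bipotent:
  assumes P: odd_quasi_zero and ab: "a \<in> T" "b \<in> T" "a \<noteq> b"
  shows "a + b = a \<or> a + b = b"
proof (rule ccontr)
  assume "\<not> ?thesis"
  then have ne: "a + b \<noteq> a" "a + b \<noteq> b" by auto
  have e: "e = 1" using P by (simp add: odd_quasi_zero_def)
  have 1: "a + b + b = a" using absorb[of a b] ab ne e by auto
  have 2: "a + b + a = b" using absorb[of b a] ab ne e by (auto simp: add.commute)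
  have "a + a = (a + b + b) + a" using 1 by simp
  also have "\<dots> = (a + b + a) + b" by (simp add: ac_simps)
  also have "\<dots> = b + b" using 2 by simp
  finally have "a + (a + a) = a" using 1 by (simp add: add.assoc)
  then have "a * (1 + (1 + 1)) = a * 1" by (simp only: distrib_left mult_1_right)
  then have three: "1 + (1 + 1) = (1::'a)" using T_cancel ab by blast
  have odd1: "of_nat (2 * l + 1) = (1::'a)" for l
  proof (induction l)
    case (Suc l)
    have "2 * Suc l + 1 = (2 * l + 1) + (1 + 1)" by simp
    then have "of_nat (2 * Suc l + 1) = of_nat (2 * l + 1) + (1 + 1 :: 'a)"
      by (simp only: of_nat_add of_nat_1)
    then show ?case by (simp only: Suc three)
  qed simp
  obtain m c where "odd m" "c \<in> T" "of_nat m * c \<in> Z"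
    using P by (auto simp: odd_quasi_zero_def)
  moreover obtain l where "m = 2 * l + 1" using \<open>odd m\<close> oddE by blast
  ultimately show False using odd1[of l] T_not_Z by auto
qed

text \<open>For odd \<open>k\<close>, the normal form writes \<open>of_nat k * a\<close> as an even
  multiple of a tangible \<open>b\<close>. Comparing \<open>a\<close> with \<open>b\<close> turns
  this into an even multiple of \<open>a\<close>, and \<open>a\<close> cancels.\<close>

lemma odd_quasi_zero_of_nat:
  assumes P: odd_quasi_zero and a: "a \<in> T" and k: "of_nat k * a \<in> Z"
  shows "of_nat k \<in> Z"
proof (cases "even k")
  case True
  then show ?thesis using of_nat_even_Z[of k 1] P by (simp add: odd_quasi_zero_def)
next
  case False
  then obtain k' where k': "k = Suc k'" by (cases k) auto
  have e: "e = 1" using P by (simp add: odd_quasi_zero_def)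
  obtain x where x: "of_nat k * a = (1 + 1) * x" using k e by (auto simp: Z_iff)
  obtain l b where b: "b \<in> T" "x = of_nat l * b"
    using normal_form[of x] e by (auto simp: normal_form_def)
  have kx: "of_nat k * a = of_nat (2 * l) * b" using x b by (simp add: mult.assoc)
  have even_eq: "of_nat k \<in> Z" if "of_nat k * a = of_nat j * a" "even j" for j
  proof -
    have "a * of_nat k = a * of_nat j" using that by (simp add: mult.commute)
    then have "of_nat k = (of_nat j :: 'a)" using T_cancel a by blast
    then show ?thesis using of_nat_even_Z[of j 1] e that by simp
  qed
  consider "a = b" | "a + b = a" | "a + b = b" using odd_quasi_zero_bipotent P a b by blast
  then show ?thesis
  proof cases
    case 1
    then show ?thesis using kx even_eq[of "2 * l"] by simp
  next
    case 2
    \<comment> \<open>Since \<open>a\<close> absorbs every copy of \<open>b\<close>, the element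
      \<open>of_nat k * a\<close> equals its own double.\<close>
    have "of_nat k * a + of_nat k * a = of_nat k' * a + (a + of_nat (2 * l) * b)"
      unfolding kx[symmetric] using k' by (simp add: algebra_simps)
    also have "\<dots> = of_nat k * a"
      unfolding add_of_nat_absorb[OF 2] using k' by (simp add: algebra_simps)
    finally have "of_nat k * a = of_nat (k + k) * a" by (simp add: distrib_right)
    then show ?thesis using even_eq[of "k + k"] by simp
  next
    case 3
    show ?thesis
    proof (cases l)
      case 0 then show ?thesis using kx even_eq[of 0] by simp
    next
      case (Suc l')
      \<comment> \<open>One further \<open>a\<close> is absorbed by \<open>b\<close>, so the odd
        \<open>k\<close> can be raised to the even \<open>k + 1\<close>.\<close>
      have "of_nat (k + 1) * a = a + of_nat (2 * l) * b"
        unfolding kx[symmetric] by (simp add: algebra_simps)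
      also have "\<dots> = (a + b) + of_nat (2 * l' + 1) * b" using Suc by (simp add: algebra_simps)
      also have "\<dots> = of_nat (2 * l) * b" using 3 Suc by (simp add: algebra_simps)
      finally show ?thesis using even_eq[of "k + 1"] kx False by simp
    qed
  qed
qed

text \<open>By normal forms: for \<open>e = 1\<close> and an odd multiple
  \<open>of_nat k * t\<close>, already \<open>of_nat k\<close> is a quasi-zero; for
  \<open>e \<noteq> 1\<close>, a tangible \<open>z\<close> would make \<open>c * z\<close>
  tangible.\<close>

lemma Z_cancel:
  assumes c: "c \<in> T" and cz: "c * z \<in> Z"
  shows "z \<in> Z"
proof (cases "e = 1")
  case True
  then obtain k t where z: "t \<in> T" "z = of_nat k * t" using normal_form[of z] by (auto simp: normal_form_def)
  show ?thesis
  proof (cases "even k")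
    case True then show ?thesis using z of_nat_even_Z \<open>e = 1\<close> by simp
  next
    case False
    have ck: "of_nat k * (c * t) \<in> Z" using cz z by (simp add: ac_simps)
    then have odd_quasi_zero using \<open>e = 1\<close> False T_mult[OF c z(1)] by (auto simp: odd_quasi_zero_def)
    then have "of_nat k \<in> Z" using odd_quasi_zero_of_nat ck T_mult[OF c z(1)] by blast
    then show ?thesis using Z_mult[of "of_nat k" t] z by (simp add: mult.commute)
  qed
next
  case False
  then consider "z = 0" | "z \<in> T" | t where "z = t + e * t"
    using normal_form[of z] by (auto simp: normal_form_def)
  then show ?thesis
    using Z_0 Z_I T_not_Z T_mult c cz by cases auto
qed


section \<open>Multilinear expansion of the determinant\<close>

lemma neg_det_eq:
  "neg_det neg B = (\<Sum>p\<in>{p. p permutes (UNIV::'n::finite set)}.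
     (if evenperm p then 1 else e) * (\<Prod>i\<in>UNIV. B i (p i)))"
  unfolding neg_det_def by (intro sum.cong refl) (simp add: neg_sign_def neg_eq)

lemma neg_det_scale: "neg_det neg (\<lambda>i j. w i * B i j) = (\<Prod>i\<in>UNIV. w i) * neg_det neg B"
  for B :: "'n::finite \<Rightarrow> 'n \<Rightarrow> 'a"
  unfolding neg_det_eq by (simp add: prod.distrib sum_distrib_left ac_simps)

lemma neg_det_row:
  "neg_det neg (B(j := w)) = (\<Sum>p\<in>{p. p permutes (UNIV::'n::finite set)}.
     (if evenperm p then 1 else e) * (w (p j) * (\<Prod>i\<in>UNIV - {j}. B i (p i))))"
proof -
  have "(\<Prod>i\<in>UNIV. (B(j := w)) i (p i)) = w (p j) * (\<Prod>i\<in>UNIV - {j}. B i (p i))" for p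
  proof -
    have "(\<Prod>i\<in>UNIV - {j}. (B(j := w)) i (p i)) = (\<Prod>i\<in>UNIV - {j}. B i (p i))"
      by (rule prod.cong) auto
    then show ?thesis by (simp add: prod.remove[of UNIV j])
  qed
  then show ?thesis unfolding neg_det_eq by simp
qed

lemma neg_det_vec_sums:
  fixes B :: "'n::finite \<Rightarrow> 'n \<Rightarrow> 'a"
  assumes X: "\<And>B. (\<And>j. B j \<in> X) \<Longrightarrow> neg_det neg B \<in> Z"
    and B: "\<And>j. B j \<in> vec_sums X"
  shows "neg_det neg B \<in> Z"
proof -
  \<comment> \<open>\<open>J\<close> contains the rows known only to be sums of generators; they are
    expanded one at a time.\<close>
  have "neg_det neg B \<in> Z" if "finite J" "\<forall>j\<in>J. B j \<in> vec_sums X" "\<forall>j\<in>-J. B j \<in> X"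
    for J and B :: "'n \<Rightarrow> 'n \<Rightarrow> 'a"
    using that
  proof (induction J arbitrary: B rule: finite_induct)
    case empty
    then show ?case by (intro X) auto
  next
    case (insert j J)
    have "neg_det neg (B(j := v)) \<in> Z" if "v \<in> vec_sums X" for v
      using that
    proof induction
      case zero
      show ?case unfolding neg_det_row by (simp add: Z_0)
    next
      case (add x u)
      have "neg_det neg (B(j := x)) \<in> Z"
        using insert.prems insert.hyps add by (intro insert.IH) auto
      moreover have "neg_det neg (B(j := \<lambda>i. x i + u i)) =
          neg_det neg (B(j := x)) + neg_det neg (B(j := u))"
        unfolding neg_det_row sum.distrib[symmetric] by (simp add: algebra_simps)
      ultimately show ?case using Z_add[OF _ add.IH] by presburger
    qed
    from this[of "B j"] show ?case using insert.prems by simp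
  qed
  from this[of UNIV B] show ?thesis using B by simp
qed

subsubsection \<open>Vectors in the absence of odd quasi-zeros\<close>

definition null_vecs :: "'n::finite set \<Rightarrow> ('n \<Rightarrow> 'a) set" where
  "null_vecs S = {\<lambda>i. w * x i | w x. \<exists>z. (\<forall>i. specializes e (x i) (z i)) \<and> (\<Sum>i\<in>S. z i) = 0}"

lemma null_vecsI:
  "(\<And>i. specializes e (x i) (z i)) \<Longrightarrow> (\<Sum>i\<in>S. z i) = 0 \<Longrightarrow> (\<lambda>i. w * x i) \<in> null_vecs S"
  unfolding null_vecs_def by blast

text \<open>The specialized real matrix kills the indicator vector \<open>s\<close> of
  \<open>S\<close>, so its determinant is 0. Specialization respects the Leibniz formula, and the
  factors \<open>w j\<close> come out of the rows.\<close>

lemma neg_det_null_vecs: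
  fixes B :: "'n::finite \<Rightarrow> 'n \<Rightarrow> 'a"
  assumes S: "S \<noteq> {}" and B: "\<And>j. B j \<in> null_vecs S"
  shows "neg_det neg B \<in> Z"
proof -
  have "\<forall>j. \<exists>w x z. B j = (\<lambda>i. w * x i) \<and> (\<forall>i. specializes e (x i) (z i)) \<and> (\<Sum>i\<in>S. z i) = 0"
    using B unfolding null_vecs_def by blast
  then obtain w x z where wxz: "\<And>j. B j = (\<lambda>i. w j * x j i)"
    "\<And>j i. specializes e (x j i) (z j i)" "\<And>j. (\<Sum>i\<in>S. z j i) = 0"
    by metis
  define M :: "real^'n^'n" where "M = (\<chi> j i. z j i)"
  define s :: "real^'n" where "s = (\<chi> i. if i \<in> S then 1 else 0)"
  have "M *v s = 0"
    using wxz(3) by (simp add: vec_eq_iff matrix_vector_mult_def M_def s_def if_distrib sum.If_cases cong: if_cong)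
  moreover have "s \<noteq> 0" using S by (auto simp: vec_eq_iff s_def)
  ultimately have "\<not> inj ((*v) M)" by (metis injD matrix_vector_mult_0_right)
  then have det0: "det M = 0" using det_nz_iff_inj[OF matrix_vector_mul_linear, of M] by simp
  have "specializes e (neg_det neg x) (det M)"
    unfolding neg_det_eq det_def
  proof (rule specializes_sum, rule specializes_mult[OF e_e])
    fix p :: "'n \<Rightarrow> 'n"
    show "specializes e (if evenperm p then 1 else e) (of_int (sign p))"
      by (simp add: sign_def specializes_1 specializes_unit)
    show "specializes e (\<Prod>i\<in>UNIV. x i (p i)) (\<Prod>i\<in>UNIV. M $ i $ p i)"
      using wxz(2) by (intro specializes_prod[OF e_e]) (simp add: M_def)
  qed
  then obtain P where "neg_det neg x = of_nat P + of_nat P * e"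
    unfolding det0 specializes_def by auto
  then have "neg_det neg x = (1 + e) * of_nat P" by (simp add: algebra_simps)
  then have "neg_det neg x \<in> Z" unfolding Z_iff by blast
  moreover have "neg_det neg B = (\<Prod>j\<in>UNIV. w j) * neg_det neg x"
    unfolding neg_det_scale[symmetric] using wxz(1) by (intro arg_cong[of _ _ "neg_det neg"] ext) simp
  ultimately show ?thesis using Z_mult by simp
qed

text \<open>For \<open>i = k\<close> both summands meet in one coordinate and form the quasi-zero
  \<open>w + e * w\<close>.\<close>

definition pair_vec :: "'a \<Rightarrow> 'n \<Rightarrow> 'n \<Rightarrow> 'n \<Rightarrow> 'a" where
  "pair_vec w i k l = (if l = i then w else 0) + (if l = k then e * w else 0)"

definition pair_vecs :: "'n set \<Rightarrow> ('n \<Rightarrow> 'a) set" where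
  "pair_vecs S = {pair_vec w i k | w i k. i \<in> S \<and> k \<in> S}"

lemma pair_vec_sums: "i \<in> S \<Longrightarrow> k \<in> S \<Longrightarrow> pair_vec w i k \<in> vec_sums (pair_vecs S)"
  unfolding pair_vecs_def by (rule vec_sums_base) blast

text \<open>To each generator touching \<open>i\<close>, add the same pair with \<open>i\<close>
  replaced by \<open>k\<close>; any other endpoint is merely repeated, which idempotence makes
  harmless.\<close>

lemma vec_sums_copy_entry:
  assumes idem: "\<And>y::'a. y + y = y" and ik: "i \<in> S" "k \<in> S"
    and u: "u \<in> vec_sums (pair_vecs S)"
  shows "(\<lambda>l. u l + (if l = k then u i else 0)) \<in> vec_sums (pair_vecs S)"
  using u
proof induction
  case zero
  then show ?case by (simp add: vec_sums.zero)
next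
  case (add x u)
  obtain w p q where x: "x = pair_vec w p q" "p \<in> S" "q \<in> S"
    using add.hyps(1) unfolding pair_vecs_def by auto
  have idem2: "y + (y + z) = y + z" for y z :: 'a
    using idem[of y] by (simp add: add.assoc[symmetric])
  have "(\<lambda>l. x l + (if l = k then x i else 0)) \<in> vec_sums (pair_vecs S)"
  proof (cases "p = i"; cases "q = i")
    assume "p = i" "q = i"
    then have "(\<lambda>l. x l + (if l = k then x i else 0)) = (\<lambda>l. pair_vec w i i l + pair_vec w k k l)"
      by (auto simp: x pair_vec_def fun_eq_iff)
    then show ?thesis using ik by (simp add: vec_sums_add pair_vec_sums)
  next
    assume "p = i" "q \<noteq> i"
    then have "(\<lambda>l. x l + (if l = k then x i else 0)) = (\<lambda>l. pair_vec w i q l + pair_vec w k q l)"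
      by (auto simp: x pair_vec_def fun_eq_iff idem idem2 ac_simps)
    then show ?thesis using ik x by (simp add: vec_sums_add pair_vec_sums)
  next
    assume "p \<noteq> i" "q = i"
    then have "(\<lambda>l. x l + (if l = k then x i else 0)) = (\<lambda>l. pair_vec w p i l + pair_vec w p k l)"
      by (auto simp: x pair_vec_def fun_eq_iff idem idem2 ac_simps)
    then show ?thesis using ik x by (simp add: vec_sums_add pair_vec_sums)
  next
    assume "p \<noteq> i" "q \<noteq> i"
    then have "(\<lambda>l. x l + (if l = k then x i else 0)) = x"
      by (auto simp: x pair_vec_def fun_eq_iff)
    then show ?thesis using x by (simp add: pair_vec_sums)
  qed
  from vec_sums_add[OF this add.IH]
  show ?case by (rule back_subst[of "\<lambda>f. f \<in> vec_sums (pair_vecs S)"]) (auto simp: fun_eq_iff ac_simps)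
qed

text \<open>
  Two entries with a tangible sum are merged; by the absorption lemma the merged entry can be
  split again, except when both are equal and \<open>1 + 1 = 1\<close>, where it can simply be copied.
\<close>

lemma pair_vec_decomposition:
  fixes x :: "'n::finite \<Rightarrow> 'a"
  assumes no_odd: "\<not> odd_quasi_zero"
    and "\<And>i. x i \<in> T \<union> {0}" "\<And>i. x i \<noteq> 0 \<Longrightarrow> i \<in> S" "(\<Sum>i\<in>UNIV. x i) \<in> Z"
  shows "x \<in> vec_sums (pair_vecs S)"
  using assms(2-)
proof (induction "card {i. x i \<noteq> 0}" arbitrary: x rule: less_induct)
  case less
  have T: "x i \<in> T" if "x i \<noteq> 0" for i using less.prems(1)[of i] that by auto
  have split: "(\<Sum>l\<in>UNIV. f l) = f i + (f k + (\<Sum>l\<in>UNIV - {i} - {k}. f l))" if "i \<noteq> k"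
    for f :: "'n \<Rightarrow> 'a" and i k
    using that by (simp add: sum.remove[of UNIV i] sum.remove[of "UNIV - {i}" k])
  show ?case
  proof (cases "\<exists>i k. i \<noteq> k \<and> x i \<noteq> 0 \<and> x k \<noteq> 0 \<and> x k \<noteq> e * x i")
    case True
    then obtain i k where ik: "i \<noteq> k" "x i \<noteq> 0" "x k \<noteq> 0" "x k \<noteq> e * x i" by blast
    then have ki: "x i \<noteq> e * x k" using e_e_mult by metis
    \<comment> \<open>Moving the entry at \<open>k\<close> onto \<open>i\<close> preserves the total
      and shrinks the support.\<close>
    have merged: "x(i := x i + x k, k := 0) \<in> vec_sums (pair_vecs S)"
      if "i \<noteq> k" "x i \<noteq> 0" "x k \<noteq> 0" "x k \<noteq> e * x i" for i k
    proof (rule less.hyps)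
      let ?y = "x(i := x i + x k, k := 0)"
      show "card {l. ?y l \<noteq> 0} < card {l. x l \<noteq> 0}"
        by (rule psubset_card_mono) (use that in auto)
      show "?y l \<in> T \<union> {0}" for l
        using T_add[OF T T, of i k] that less.prems(1)[of l] by auto
      show "l \<in> S" if "?y l \<noteq> 0" for l
        using that less.prems(2)[of l] less.prems(2)[of i] \<open>x i \<noteq> 0\<close> by (auto split: if_splits)
      have "(\<Sum>l\<in>UNIV - {i} - {k}. ?y l) = (\<Sum>l\<in>UNIV - {i} - {k}. x l)"
        by (rule sum.cong) auto
      then have "(\<Sum>l\<in>UNIV. ?y l) = (\<Sum>l\<in>UNIV. x l)"
        using that(1) by (simp add: split[OF that(1)] add.assoc)
      then show "(\<Sum>l\<in>UNIV. ?y l) \<in> Z" using less.prems by simp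
    qed
    have unmerge: "x \<in> vec_sums (pair_vecs S)"
      if "i \<noteq> k" "x i \<noteq> 0" "x k \<noteq> 0" "x k \<noteq> e * x i" "x i + x k + e * x k = x i" for i k
    proof -
      have "x = (\<lambda>l. pair_vec (x k) k i l + (x(i := x i + x k, k := 0)) l)"
        using that(1,5) by (auto simp: fun_eq_iff pair_vec_def ac_simps)
      then show ?thesis
        using vec_sums_add[OF pair_vec_sums[of k S i "x k"] merged[OF that(1-4)]] less.prems(2) that by simp
    qed
    consider "x i + x k \<noteq> x k" | "x i + x k \<noteq> x i" | "x i + x k = x k" "x i + x k = x i" by blast
    then show ?thesis
    proof cases
      case 1
      then show ?thesis using unmerge[of i k] ik absorb[of "x i" "x k"] T by blast
    next
      case 2
      then show ?thesis using unmerge[of k i] ik ki absorb[of "x k" "x i"] T by (auto simp: add.commute)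
    next
      case 3
      then have eq: "x k = x i" by simp
      then have "x i * (1 + 1) = x i * 1" using 3 by (simp only: distrib_left mult_1_right)
      then have "1 + 1 = (1::'a)" using T_cancel T[of i] ik by blast
      then have idem: "y + y = y" for y :: 'a by (metis distrib_right mult_1)
      have "x = (\<lambda>l. (x(i := x i + x k, k := 0)) l +
          (if l = k then (x(i := x i + x k, k := 0)) i else 0))"
        using ik(1) 3 eq by (auto simp: fun_eq_iff)
      also have "\<dots> \<in> vec_sums (pair_vecs S)"
        by (rule vec_sums_copy_entry[OF idem _ _ merged[OF ik]]) (use less.prems(2) ik in auto)
      finally show ?thesis .
    qed
  next
    case False
    then have opp: "x k = e * x i" if "i \<noteq> k" "x i \<noteq> 0" "x k \<noteq> 0" for i k using that by blast
    show ?thesis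
    proof (cases "\<exists>i. x i \<noteq> 0")
      case False
      then have "x = (\<lambda>_. 0)" by auto
      then show ?thesis by (simp add: vec_sums.zero)
    next
      case True
      then obtain i where i: "x i \<noteq> 0" by blast
      \<comment> \<open>A single nonzero entry would make the total tangible.\<close>
      have "\<exists>k. k \<noteq> i \<and> x k \<noteq> 0"
      proof (rule ccontr)
        assume "\<not> ?thesis"
        then have "(\<Sum>l\<in>UNIV. x l) = (\<Sum>l\<in>{i}. x l)" by (intro sum.mono_neutral_right) auto
        then have "(\<Sum>l\<in>UNIV. x l) = x i" by simp
        then show False using less.prems(3) T[OF i] T_not_Z by simp
      qed
      then obtain k where k: "k \<noteq> i" "x k \<noteq> 0" by blast
      have xk: "x k = e * x i" by (rule opp) (use i k in auto)
      let ?y = "x(i := 0, k := 0)"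
      have "?y \<in> vec_sums (pair_vecs S)"
      proof (rule less.hyps)
        show "card {l. ?y l \<noteq> 0} < card {l. x l \<noteq> 0}"
          by (rule psubset_card_mono) (use k in auto)
        show "?y l \<in> T \<union> {0}" for l using less.prems(1)[of l] by auto
        show "l \<in> S" if "?y l \<noteq> 0" for l using that less.prems(2)[of l] by (auto split: if_splits)
        show "(\<Sum>l\<in>UNIV. ?y l) \<in> Z"
        proof (cases "\<exists>l. l \<noteq> i \<and> l \<noteq> k \<and> x l \<noteq> 0")
          case False
          then have "(\<Sum>l\<in>UNIV. ?y l) = 0" by (intro sum.neutral) auto
          then show ?thesis using Z_0 by simp
        next
          case True
          then obtain l where l: "l \<noteq> i" "l \<noteq> k" "x l \<noteq> 0" by blast
          \<comment> \<open>A third nonzero entry is opposite to both \<open>x i\<close> and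
            \<open>x k\<close>, which forces \<open>e = 1\<close> and makes all nonzero entries
            equal. Without odd quasi-zeros their number is even, and it stays even when two are
            removed.\<close>
          have "x l = e * x i" "x l = e * x k" by (rule opp; use i k l in auto)+
          then have "x i * 1 = x i * e" using xk e_e_mult by (simp add: mult.commute)
          then have e: "e = 1" using T_cancel[OF T[OF i], of 1 e] by simp
          have all: "x m = x i" if "x m \<noteq> 0" for m using opp[of i m] i that e by (cases "m = i") auto
          define U where "U = {m. x m \<noteq> 0} - {i} - {k}"
          have U: "{m. x m \<noteq> 0} = insert i (insert k U)" "i \<notin> U" "k \<notin> U"
            using i k by (auto simp: U_def)
          have "(\<Sum>m\<in>UNIV. x m) = (\<Sum>m\<in>{m. x m \<noteq> 0}. x m)"
            by (rule sum.mono_neutral_right) auto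
          also have "\<dots> = (\<Sum>m\<in>{m. x m \<noteq> 0}. x i)" by (rule sum.cong) (use all in auto)
          also have "\<dots> = of_nat (card {m. x m \<noteq> 0}) * x i" by simp
          finally have "of_nat (card {m. x m \<noteq> 0}) * x i \<in> Z" using less.prems(3) by simp
          then have "even (card {m. x m \<noteq> 0})"
            using no_odd e T[OF i] by (auto simp: odd_quasi_zero_def)
          then have "even (card U)" unfolding U(1) using U(2,3) k by simp
          have "(\<Sum>m\<in>UNIV. ?y m) = (\<Sum>m\<in>U. ?y m)"
            by (rule sum.mono_neutral_right) (auto simp: U_def)
          also have "\<dots> = (\<Sum>m\<in>U. x i)" by (rule sum.cong) (use all in \<open>auto simp: U_def\<close>)
          also have "\<dots> = of_nat (card U) * x i" by simp
          finally show ?thesis using of_nat_even_Z[OF e \<open>even (card U)\<close>] by simp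
        qed
      qed
      then have "(\<lambda>l. pair_vec (x i) i k l + ?y l) \<in> vec_sums (pair_vecs S)"
        by (intro vec_sums_add pair_vec_sums less.prems(2) i k)
      also have "(\<lambda>l. pair_vec (x i) i k l + ?y l) = x"
        using k(1) xk by (auto simp: fun_eq_iff pair_vec_def)
      finally show ?thesis .
    qed
  qed
qed

lemma pair_vecs_null: "pair_vecs S \<subseteq> null_vecs S"
proof
  fix u assume "u \<in> pair_vecs S"
  then obtain w i k where u: "u = pair_vec w i k" "i \<in> S" "k \<in> S" unfolding pair_vecs_def by auto
  let ?x = "\<lambda>l. (if l = i then 1 else 0) + (if l = k then e else 0)"
  let ?z = "\<lambda>l. (if l = i then 1 else 0) + (if l = k then -1 else (0::real))"
  have "u = (\<lambda>l. w * ?x l)" by (auto simp: u pair_vec_def fun_eq_iff algebra_simps)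
  moreover have "specializes e (?x l) (?z l)" for l
    by (intro specializes_add) (auto simp: specializes_0 specializes_1 specializes_unit)
  moreover have "(\<Sum>l\<in>S. ?z l) = 0" using u by (simp add: sum.distrib)
  ultimately show "u \<in> null_vecs S" using null_vecsI[of ?x ?z S w] by simp
qed

text \<open>Pair vectors handle the coordinates in \<open>S\<close>. The others do not enter the sum
  over \<open>S\<close>, so multiples of their unit vectors are already null vectors.\<close>

lemma null_vec_decomposition:
  fixes x :: "'n::finite \<Rightarrow> 'a"
  assumes no_odd: "\<not> odd_quasi_zero"
    and x: "\<And>i. i \<in> S \<Longrightarrow> x i \<in> T \<union> {0}" "(\<Sum>i\<in>S. x i) \<in> Z"
  shows "x \<in> vec_sums (null_vecs S)"
proof -
  let ?r = "\<lambda>l. if l \<in> S then x l else 0"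
  have "?r \<in> vec_sums (pair_vecs S)"
    using x by (intro pair_vec_decomposition[OF no_odd]) (auto simp: sum.If_cases split: if_splits)
  then have r: "?r \<in> vec_sums (null_vecs S)"
    using vec_sums_mono[of "pair_vecs S" "null_vecs S"] pair_vecs_null vec_sums_base by blast
  have "(\<lambda>l. x i * (if l = i then 1 else 0)) \<in> null_vecs S" if "i \<in> - S" for i
  proof -
    have "specializes e (if l = i then 1 else 0) (if l = i then 1 else 0)" for l
      by (simp add: specializes_0 specializes_1)
    moreover have "(\<Sum>l\<in>S. if l = i then 1 else (0::real)) = 0" using that by simp
    ultimately show ?thesis by (rule null_vecsI)
  qed
  then have "(\<lambda>l. \<Sum>i\<in>-S. x i * (if l = i then 1 else 0)) \<in> vec_sums (null_vecs S)"
    by (intro vec_sums_sum vec_sums_base)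
  from vec_sums_add[OF r this] show ?thesis
    by (rule back_subst[of "\<lambda>f. f \<in> vec_sums (null_vecs S)"]) (auto simp: fun_eq_iff if_distrib cong: if_cong)
qed

subsubsection \<open>Vectors in the presence of odd quasi-zeros\<close>

definition layered_vecs :: "nat \<Rightarrow> 'n::finite set \<Rightarrow> ('n \<Rightarrow> 'a) set" where
  "layered_vecs N S = {\<lambda>i. a * of_nat (u i) | a u. even_or_ge N (\<Sum>i\<in>S. u i)}"

text \<open>For \<open>e = 1\<close> the determinant is a permanent. Without the factors
  \<open>a j\<close> it is a natural number that is even or exceeds the quasi-zero \<open>N\<close>
  by an even amount.\<close>

lemma neg_det_layered_vecs:
  fixes B :: "'n::finite \<Rightarrow> 'n \<Rightarrow> 'a"
  assumes e: "e = 1" and N: "odd N" "of_nat N \<in> Z"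
    and S: "S \<noteq> {}" and B: "\<And>j. B j \<in> layered_vecs N S"
  shows "neg_det neg B \<in> Z"
proof -
  have "\<forall>j. \<exists>a u. B j = (\<lambda>i. a * of_nat (u i)) \<and> even_or_ge N (\<Sum>i\<in>S. u i)"
    using B unfolding layered_vecs_def by blast
  then obtain a u where au: "\<And>j. B j = (\<lambda>i. a j * of_nat (u j i))" "\<And>j. even_or_ge N (\<Sum>i\<in>S. u j i)"
    by metis
  define D where "D = (\<Sum>p\<in>{p. p permutes (UNIV::'n set)}. \<Prod>j\<in>UNIV. u j (p j))"
  have "even_or_ge N D" unfolding D_def using even_or_ge_permanent[OF S] au(2) by blast
  have "of_nat D \<in> Z"
  proof (cases "even D")
    case True then show ?thesis using of_nat_even_Z[OF e, of D 1] by simp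
  next
    case False
    then have "N \<le> D" "even (D - N)" using \<open>even_or_ge N D\<close> N by (auto simp: even_or_ge_def)
    then have "of_nat D = of_nat N + of_nat (D - N) * (1::'a)" by (simp add: of_nat_add[symmetric] del: of_nat_add)
    then show ?thesis using Z_add[OF N(2) of_nat_even_Z[OF e \<open>even (D - N)\<close>, of 1]] by simp
  qed
  moreover have "neg_det neg (\<lambda>j i. of_nat (u j i)) = of_nat D"
    unfolding neg_det_eq e D_def by simp
  moreover have "neg_det neg B = (\<Prod>j\<in>UNIV. a j) * neg_det neg (\<lambda>j i. of_nat (u j i))"
    unfolding neg_det_scale[symmetric] using au(1) by (intro arg_cong[of _ _ "neg_det neg"] ext) simp
  ultimately show ?thesis using Z_mult by simp
qed

text \<open>Bipotency orders tangibles by absorption, so a finite nonempty set has a top element.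
  The case \<open>b = a\<close> is separate because \<open>a + a\<close> is a quasi-zero and hence
  not \<open>a\<close>.\<close>

lemma dominating_element:
  assumes odd_quasi_zero "finite F" "F \<noteq> {}" "F \<subseteq> T"
  shows "\<exists>a\<in>F. \<forall>b\<in>F. b = a \<or> a + b = a"
  using assms(2-)
proof (induction rule: finite_ne_induct)
  case (insert b F)
  then obtain a where a: "a \<in> F" "\<forall>c\<in>F. c = a \<or> a + c = a" by auto
  consider "a = b" | "a + b = a" | "a + b = b"
    using odd_quasi_zero_bipotent[OF assms(1), of a b] a insert.prems by auto
  then show ?case
  proof cases
    case 3
    have "b + c = b" if "c \<in> F" for c
      using a(2) that 3 by (metis add.assoc add.commute)
    then show ?thesis by auto
  qed (use a in auto)
qed simp

lemma add_sum_absorb: "(\<And>i. i \<in> F \<Longrightarrow> a + f i = (a::'a)) \<Longrightarrow> a + (\<Sum>i\<in>F. f i) = a"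
proof (induction F rule: infinite_finite_induct)
  case (insert x F)
  then show ?case by (simp add: add.assoc[symmetric])
qed auto

text \<open>The dominating entry \<open>a\<close> absorbs all lower ones in \<open>S\<close>, so the
  total is \<open>card U\<close> times \<open>a\<close>, with \<open>U\<close> the positions of
  \<open>a\<close>. This makes the \<open>U\<close>-part layered; lower entries and entries outside
  \<open>S\<close> are added separately.\<close>

lemma layered_vec_decomposition:
  fixes x :: "'n::finite \<Rightarrow> 'a"
  assumes odd: odd_quasi_zero
    and N: "\<And>k. odd k \<Longrightarrow> of_nat k \<in> Z \<Longrightarrow> N \<le> k"
    and x: "\<And>i. i \<in> S \<Longrightarrow> x i \<in> T \<union> {0}" "(\<Sum>i\<in>S. x i) \<in> Z"
  shows "x \<in> vec_sums (layered_vecs N S)"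
proof -
  let ?V = "vec_sums (layered_vecs N S)"
  have layered: "(\<lambda>l. a * of_nat (u l)) \<in> ?V" if "even_or_ge N (\<Sum>i\<in>S. u i)" for a u
    using that unfolding layered_vecs_def by (intro vec_sums_base) blast
  have "(\<lambda>l. x i * of_nat (if l = i then 1 else 0)) \<in> ?V" if "i \<in> -S" for i
    using that by (intro layered) (simp add: even_or_ge_def)
  then have outside: "(\<lambda>l. \<Sum>i\<in>-S. x i * of_nat (if l = i then 1 else 0)) \<in> ?V"
    by (rule vec_sums_sum)
  have outside_eq: "(\<Sum>i\<in>-S. x i * of_nat (if l = i then 1 else 0)) = (if l \<in> S then 0 else x l)" for l
    by (simp add: if_distrib cong: if_cong)
  show ?thesis
  proof (cases "\<exists>i\<in>S. x i \<noteq> 0")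
    case False
    then have "x = (\<lambda>l. \<Sum>i\<in>-S. x i * of_nat (if l = i then 1 else 0))"
      unfolding outside_eq by auto
    then show ?thesis using outside by simp
  next
    case True
    obtain a where a: "a \<in> x ` {i\<in>S. x i \<noteq> 0}" "\<forall>b\<in>x ` {i\<in>S. x i \<noteq> 0}. b = a \<or> a + b = a"
      using dominating_element[OF odd, of "x ` {i\<in>S. x i \<noteq> 0}"] True x(1) by auto
    then obtain m where m: "m \<in> S" "x m = a" "a \<noteq> 0" by auto
    then have "a \<in> T" using x(1)[of m] by auto
    define U where "U = {i\<in>S. x i = a}"
    have small: "a + x i = a" if "i \<in> S - U" for i
      using a(2) that by (cases "x i = 0") (auto simp: U_def)
    \<comment> \<open>One copy of \<open>a\<close> is set aside to absorb the lower entries.\<close>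
    obtain c where c: "card U = Suc c"
      using m by (cases "card U") (auto simp: U_def)
    have low_absorbed: "a + (\<Sum>i\<in>S - U. x i) = a" by (rule add_sum_absorb) (rule small)
    have "(\<Sum>i\<in>S. x i) = (\<Sum>i\<in>S - U. x i) + (\<Sum>i\<in>U. x i)"
      by (rule sum.subset_diff) (auto simp: U_def)
    also have "(\<Sum>i\<in>U. x i) = (\<Sum>i\<in>U. a)" by (rule sum.cong) (auto simp: U_def)
    also have "\<dots> = of_nat c * a + a" using c by (simp add: algebra_simps)
    finally have "(\<Sum>i\<in>S. x i) = of_nat c * a + (a + (\<Sum>i\<in>S - U. x i))" by (simp add: ac_simps)
    also have "\<dots> = of_nat (card U) * a"
      unfolding low_absorbed using c by (simp add: algebra_simps)
    finally have "of_nat (card U) \<in> Z"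
      using x(2) odd_quasi_zero_of_nat[OF odd \<open>a \<in> T\<close>] by simp
    then have "even_or_ge N (card U)" using N by (auto simp: even_or_ge_def)
    moreover have "(\<Sum>i\<in>S. if i \<in> U then 1 else 0) = card U"
      by (simp add: sum.If_cases U_def Int_def)
    ultimately have top: "(\<lambda>l. a * of_nat (if l \<in> U then 1 else 0)) \<in> ?V"
      by (intro layered) simp
    \<comment> \<open>Placing \<open>x i\<close> at both \<open>i\<close> and \<open>m\<close> gives
      coefficient sum 2 over \<open>S\<close>; the extra copy at \<open>m\<close> disappears into
      \<open>a\<close>.\<close>
    have "(\<lambda>l. x i * of_nat ((if l = i then 1 else 0) + (if l = m then 1 else 0))) \<in> ?V"
      if "i \<in> S - U" for i
      using that m by (intro layered) (simp add: even_or_ge_def sum.distrib)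
    then have low: "(\<lambda>l. \<Sum>i\<in>S - U. x i * of_nat ((if l = i then 1 else 0) + (if l = m then 1 else 0))) \<in> ?V"
      by (rule vec_sums_sum)
    have low_eq: "(\<Sum>i\<in>S - U. x i * of_nat ((if l = i then 1 else 0) + (if l = m then 1 else 0))) =
        (if l \<in> S - U then x l else 0) + (if l = m then \<Sum>i\<in>S - U. x i else 0)" for l
    proof -
      have "(\<Sum>i\<in>S - U. x i * of_nat ((if l = i then 1 else 0) + (if l = m then 1 else 0))) =
          (\<Sum>i\<in>S - U. (if l = i then x i else 0) + (if l = m then x i else 0))"
        by (rule sum.cong) (auto simp: algebra_simps)
      then show ?thesis by (simp add: sum.distrib)
    qed
    have "a * of_nat (if l \<in> U then 1 else 0) +
        ((if l \<in> S - U then x l else 0) + (if l = m then \<Sum>i\<in>S - U. x i else 0)) +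
        (if l \<in> S then 0 else x l) = x l" for l
      using low_absorbed m by (auto simp: U_def)
    with vec_sums_add[OF vec_sums_add[OF top low] outside] show ?thesis
      unfolding low_eq outside_eq by simp
  qed
qed

section \<open>Rescaling and the two cases of the decomposition\<close>

theorem neg_det_dependent:
  fixes A :: "'n::finite \<Rightarrow> 'n \<Rightarrow> 'a"
  assumes entries: "\<forall>i j. A i j \<in> T \<union> {0}"
    and dep: "circ_dependent neg T A"
  shows "neg_det neg A \<in> Z"
proof -
  obtain S \<alpha> where S: "S \<noteq> {}" "\<forall>j\<in>S. \<alpha> j \<in> T" "\<forall>k. (\<Sum>j\<in>S. \<alpha> j * A j k) \<in> Z"
    using dep unfolding circ_dependent_def by blast
  \<comment> \<open>The value 1 off \<open>S\<close> keeps every factor tangible, so that their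
    product can be cancelled at the end.\<close>
  define \<beta> where "\<beta> i = (if i \<in> S then \<alpha> i else 1)" for i
  \<comment> \<open>Transposed, so that \<open>C k\<close> is a column of the rescaled
    matrix.\<close>
  define C where "C = (\<lambda>k i. \<beta> i * A i k)"
  have \<beta>: "\<beta> i \<in> T" for i using S one_T by (simp add: \<beta>_def)
  have C_T: "C k i \<in> T \<union> {0}" for k i
    using T_mult[OF \<beta>[of i], of "A i k"] entries[rule_format, of i k] by (auto simp: C_def)
  have C_Z: "(\<Sum>i\<in>S. C k i) \<in> Z" for k
    using S(3) by (simp add: C_def \<beta>_def)
  have "neg_det neg C \<in> Z"
  proof (cases odd_quasi_zero)
    case False
    show ?thesis
    proof (rule neg_det_vec_sums)
      show "C j \<in> vec_sums (null_vecs S)" for j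
        by (rule null_vec_decomposition[OF False C_T C_Z])
    qed (rule neg_det_null_vecs[OF S(1)])
  next
    case True
    \<comment> \<open>Minimality serves the decomposition of the columns; that \<open>N\<close> is
      an odd quasi-zero serves the evaluation of the permanents.\<close>
    define N where "N = (LEAST k. odd k \<and> of_nat k \<in> Z)"
    have "\<exists>k. odd k \<and> of_nat k \<in> Z"
      using True odd_quasi_zero_of_nat[OF True] unfolding odd_quasi_zero_def by blast
    then have "odd N \<and> of_nat N \<in> Z" unfolding N_def by (rule LeastI_ex)
    then have N: "odd N" "of_nat N \<in> Z" by auto
    have least: "N \<le> k" if "odd k" "of_nat k \<in> Z" for k
      unfolding N_def using that by (intro Least_le) simp
    have "e = 1" using True by (simp add: odd_quasi_zero_def)
    show ?thesis
    proof (rule neg_det_vec_sums)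
      show "C j \<in> vec_sums (layered_vecs N S)" for j
        by (rule layered_vec_decomposition[OF True least C_T C_Z])
    qed (rule neg_det_layered_vecs[OF \<open>e = 1\<close> N S(1)])
  qed
  moreover have "neg_det neg C = (\<Prod>i\<in>UNIV. \<beta> i) * neg_det neg A"
    unfolding C_def neg_det_transpose[of neg "\<lambda>i k. \<beta> i * A i k"] by (rule neg_det_scale)
  moreover have "(\<Prod>i\<in>F. \<beta> i) \<in> T" for F
    by (induction F rule: infinite_finite_induct) (auto intro: one_T T_mult \<beta>)
  ultimately show ?thesis using Z_cancel[of "\<Prod>i\<in>UNIV. \<beta> i" "neg_det neg A"] by simp
qed

end

theorem theorem9p4:
  fixes neg :: "'a::comm_semiring_1 \<Rightarrow> 'a"
    and T :: "'a set"
    and A :: "'n::finite \<Rightarrow> 'n \<Rightarrow> 'a"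
  assumes neg: "negation_map neg T"
    and T_nz: "T \<subseteq> UNIV - {0}"
    and T_one: "1 \<in> T"
    and T_mult: "\<forall>a\<in>T. \<forall>b\<in>T. a * b \<in> T"
    and triple: "T_triple neg T"
    and mt: "meta_tangible neg T"
    and canc: "cancelative T"
    and entries: "\<forall>i j. A i j \<in> T \<union> {0}"
    and dep: "circ_dependent neg T A"
  shows "neg_det neg A \<in> quasi_zeros neg"
proof -
  interpret cancelative_meta_tangible neg T
    by unfold_locales (fact assms)+
  show ?thesis using entries dep by (rule neg_det_dependent)
qed

end
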